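(* Let $n,k,l,r$ be integers with $k,r\geq 2$ and $n\geq l\geq t+1$, where $t=t(k,r)$. Let $p,q\geq 0$ be the integers with $n=p(l-1)+q$ and $0\leq q<l-1$, and let $s=s(k,r)$. If $H$ is a $(k,l)$-edge-maximal $r$-uniform hypergraph on $n$ vertices, then \[ |E(H)|\leq \begin{cases} p\binom{l-1}{r}+pk+\binom{q}{r}, & \text{if } l-1>s \text{ and } q>s,\\ p\binom{l-1}{r}+(p-1+q)k, & \text{if } l-1>s \text{ and } q\leq s,\\ \binom{l-1}{r}+(n-l+1)k, & \text{if } l-1\leq s. \end{cases} \]
   Context: A hypergraph $H=(V,E)$ has a finite vertex set $V$ and a set $E$ of nonempty subsets of $V$ (edges); it is $r$-uniform if every edge has exactly $r$ elements. $K_n^r$ denotes the complete $r$-uniform hypergraph on $n$ vertices (all $r$-subsets are edges; no edges if $n<r$). A subhypergraph $H'=(V',E')$ of $H$ has $V'\subseteq V$, $E'\subseteq E$ (with each edge of $E'$ contained in $V'$). For $X\subseteq V$, $d_H(X)$ is the number of edges of $H$ meeting both $X$ and $V\setminus X$. The edge-connectivity is $\kappa'(H)=\min\{d_H(X):\emptyset\neq X\subsetneq V\}$. For an $r$-subset $e$ of $V$ not in $E$, $H+e=(V,E\cup\{e\})$. An $r$-uniform hypergraph $H$ on $n$ vertices is $(k,l)$-edge-maximal if every subhypergraph $H'$ of $H$ with $|V(H')|\geq l$ satisfies $\kappa'(H')\leq k$, but for every $r$-subset $e$ of $V(H)$ with $e\notin E(H)$, $H+e$ contains a subhypergraph $H''$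 with $|V(H'')|\geq l$ and $\kappa'(H'')\geq k+1$. Binomial coefficients satisfy $\binom{n}{k}=0$ when $k>n$. For integers $k,r\geq 2$, $t=t(k,r)$ is the integer with $\binom{t-1}{r-1}\leq k<\binom{t}{r-1}$ (the largest integer with $\binom{t-1}{r-1}\le k$), and $s=s(k,r)$ is the largest integer $s$ with $k+\binom{s}{r}\leq ks$. *)

theory Defs
  imports Main
begin

datatype 'a hypergraph = Hypergraph (verts: "'a set") (edges: "'a set set")

definition hypergraph :: "'a hypergraph \<Rightarrow> bool" where
  "hypergraph H \<longleftrightarrow> finite (verts H) \<and> (\<forall>e\<in>edges H. e \<noteq> {} \<and> e \<subseteq> verts H)"

definition uniform :: "nat \<Rightarrow> 'a hypergraph \<Rightarrow> bool" where
  "uniform r H \<longleftrightarrow> (\<forall>e\<in>edges H. card e = r)"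

definition subhypergraph :: "'a hypergraph \<Rightarrow> 'a hypergraph \<Rightarrow> bool" where
  "subhypergraph H' H \<longleftrightarrow> hypergraph H' \<and> verts H' \<subseteq> verts H \<and> edges H' \<subseteq> edges H"

definition cut_degree :: "'a hypergraph \<Rightarrow> 'a set \<Rightarrow> nat" where
  "cut_degree H X = card {e \<in> edges H. e \<inter> X \<noteq> {} \<and> e \<inter> (verts H - X) \<noteq> {}}"

text \<open>The set of cuts is empty, and the value below unspecified, if there are fewer than two
  vertices. In the main theorem only hypergraphs with at least three vertices are considered,
  because \<open>l \<ge> t + 1\<close> and \<open>t \<ge> r \<ge> 2\<close> (see \<open>t_param_ge\<close>).\<close>

definition edge_connectivity :: "'a hypergraph \<Rightarrow> nat" where
  "edge_connectivity H = Min {cut_degree H X | X. X \<noteq> {} \<and> X \<subset> verts H}"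

definition add_edge :: "'a hypergraph \<Rightarrow> 'a set \<Rightarrow> 'a hypergraph" where
  "add_edge H e = Hypergraph (verts H) (insert e (edges H))"

definition edge_maximal :: "nat \<Rightarrow> nat \<Rightarrow> nat \<Rightarrow> 'a hypergraph \<Rightarrow> bool" where
  "edge_maximal r k l H \<longleftrightarrow>
     hypergraph H \<and> uniform r H \<and>
     (\<forall>H'. subhypergraph H' H \<and> card (verts H') \<ge> l \<longrightarrow> edge_connectivity H' \<le> k) \<and>
     (\<forall>e. e \<subseteq> verts H \<and> card e = r \<and> e \<notin> edges H \<longrightarrow>
        (\<exists>H''. subhypergraph H'' (add_edge H e) \<and> card (verts H'') \<ge> l \<and>
               edge_connectivity H'' \<ge> k + 1))"

definition t_param :: "nat \<Rightarrow> nat \<Rightarrow> nat" where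
  "t_param k r = (THE t. (t - 1) choose (r - 1) \<le> k \<and> k < t choose (r - 1))"

definition s_param :: "nat \<Rightarrow> nat \<Rightarrow> nat" where
  "s_param k r = (GREATEST s. k + (s choose r) \<le> k * s)"

lemma choose_unbounded: "0 < d \<Longrightarrow> m < (m + d) choose d"
proof (induction d)
  case (Suc d)
  show ?case
  proof (cases "d = 0")
    case False
    then have "m < (m + d) choose d" using Suc by simp
    also have "\<dots> \<le> (m + Suc d) choose Suc d" by simp
    finally show ?thesis .
  qed simp
qed simp

lemma t_param_eqI:
  assumes "(t - 1) choose (r - 1) \<le> k" "k < t choose (r - 1)"
  shows "t_param k r = t"
  unfolding t_param_def
proof (rule the_equality)
  fix u assume u: "(u - 1) choose (r - 1) \<le> k \<and> k < u choose (r - 1)"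
  have False if "a < b" "k < a choose (r - 1)" "(b - 1) choose (r - 1) \<le> k" for a b
    using binomial_right_mono[of a "b - 1" "r - 1"] that by linarith
  then show "u = t" using u assms by (metis linorder_neqE_nat)
qed (use assms in simp)

lemma t_param_spec:
  assumes "r \<ge> 2"
  shows "(t_param k r - 1) choose (r - 1) \<le> k" "k < t_param k r choose (r - 1)"
proof -
  define t where "t = (LEAST t. k < t choose (r - 1))"
  have ex: "k < (k + (r - 1)) choose (r - 1)"
    by (rule choose_unbounded) (use assms in simp)
  have 1: "k < t choose (r - 1)" unfolding t_def using ex by (rule LeastI)
  then have "t \<noteq> 0" using assms by (cases t) (auto simp: binomial_eq_0)
  then have "t - 1 < t" by simp
  then have 2: "(t - 1) choose (r - 1) \<le> k"
    unfolding t_def using not_less_Least linorder_not_less by blast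
  have "t_param k r = t" using 2 1 by (rule t_param_eqI)
  then show "(t_param k r - 1) choose (r - 1) \<le> k" "k < t_param k r choose (r - 1)"
    using 1 2 by simp_all
qed

lemma t_param_ge:
  assumes "k \<ge> 1" "r \<ge> 2"
  shows "t_param k r \<ge> r"
proof (rule ccontr)
  assume "\<not> r \<le> t_param k r"
  then have "t_param k r choose (r - 1) \<le> (r - 1) choose (r - 1)"
    by (intro binomial_right_mono) simp
  then show False using t_param_spec(2)[OF assms(2), of k] assms(1) by simp
qed

lemma s_param_bound:
  assumes "r \<ge> 2" "k + (s choose r) \<le> k * s"
  shows "s \<le> r + r * k"
proof (rule ccontr)
  assume "\<not> s \<le> r + r * k"
  then have s: "s > r + r * k" by simp
  have "s - 1 - (r - 1) < (s - 1 - (r - 1) + (r - 1)) choose (r - 1)"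
    by (rule choose_unbounded) (use assms in simp)
  then have "r * k < (s - 1) choose (r - 1)" using s assms by simp
  moreover have "r * (s choose r) = s * ((s - 1) choose (r - 1))"
    using binomial_absorption[of "r - 1" "s"] assms s by simp
  ultimately have "s * (r * k) < r * (s choose r)" using s by simp
  then have "r * (k * s) < r * (s choose r)" by (simp add: ac_simps)
  then show False using assms by simp
qed

lemma s_param_spec:
  assumes "r \<ge> 2"
  shows "k + (s_param k r choose r) \<le> k * s_param k r"
  unfolding s_param_def
proof (rule GreatestI_nat[where k = 1 and b = "r + r * k"])
  show "k + (1 choose r) \<le> k * 1" using assms by (simp add: binomial_eq_0)
qed (use s_param_bound assms in blast)

lemma s_param_greatest:
  assumes "r \<ge> 2" "k + (s choose r) \<le> k * s"
  shows "s \<le> s_param k r"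
  unfolding s_param_def
  by (rule Greatest_le_nat[where b = "r + r * k"]) (use s_param_bound assms in blast)+

end

theory Submission
  imports Defs
begin

text \<open>
  As long as a vertex set has at least \<open>l\<close> elements, it can be split along a cut with at most
  \<open>k\<close> edges. Splitting repeatedly gives parts of size at most \<open>l - 1\<close>, so \<open>|E| + k\<close> is at most
  \<open>\<phi> n\<close> for every superadditive \<open>\<phi>\<close> with \<open>\<phi> m \<ge> (m choose r) + k\<close> for \<open>1 \<le> m < l\<close>.
  If \<open>l - 1 > s\<close>, take \<open>\<phi> (p (l - 1) + q) = p h(l - 1) + h(q)\<close>, where \<open>h(0) = 0\<close> and
  \<open>h(x) = max ((x choose r) + k) (k x)\<close> otherwise; superadditivity is the convexity of \<open>h\<close>.
  The parameter \<open>s\<close> decides which of the two terms is the maximum.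
  If \<open>l - 1 \<le> s\<close>, the claimed bound (plus \<open>k\<close>) is itself superadditive.
\<close>

section \<open>Decomposition along small cuts\<close>

definition induced :: "'a hypergraph \<Rightarrow> 'a set \<Rightarrow> 'a hypergraph" where
  "induced H X = Hypergraph X {e \<in> edges H. e \<subseteq> X}"

lemma induced_sel [simp]:
  "verts (induced H X) = X" "edges (induced H X) = {e \<in> edges H. e \<subseteq> X}"
  by (simp_all add: induced_def)

lemma subhypergraph_induced:
  assumes "hypergraph H" "X \<subseteq> verts H"
  shows "subhypergraph (induced H X) H"
  using assms finite_subset by (auto simp: subhypergraph_def hypergraph_def)

lemma subhypergraph_refl: "hypergraph H \<Longrightarrow> subhypergraph H H"
  by (simp add: subhypergraph_def)

lemma subhypergraph_trans:
  "subhypergraph H1 H2 \<Longrightarrow> subhypergraph H2 H3 \<Longrightarrow> subhypergraph H1 H3"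
  by (auto simp: subhypergraph_def)

lemma finite_edges: "hypergraph H \<Longrightarrow> finite (edges H)"
  by (rule finite_subset[of _ "Pow (verts H)"]) (auto simp: hypergraph_def)

lemma card_edges_le_choose:
  assumes "hypergraph H" "uniform r H"
  shows "card (edges H) \<le> card (verts H) choose r"
proof -
  have fin: "finite (verts H)" using assms(1) by (simp add: hypergraph_def)
  have "edges H \<subseteq> {e. e \<subseteq> verts H \<and> card e = r}"
    using assms by (auto simp: hypergraph_def uniform_def)
  then have "card (edges H) \<le> card {e. e \<subseteq> verts H \<and> card e = r}"
    using fin by (intro card_mono) auto
  then show ?thesis using n_subsets[OF fin] by simp
qed

lemma card_edges_cut:
  assumes "hypergraph H"
  shows "card (edges H)
    \<le> card (edges (induced H X)) + card (edges (induced H (verts H - X))) + cut_degree H X"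
proof -
  let ?A = "edges (induced H X)" and ?B = "edges (induced H (verts H - X))"
  let ?C = "{e \<in> edges H. e \<inter> X \<noteq> {} \<and> e \<inter> (verts H - X) \<noteq> {}}"
  have "edges H \<subseteq> ?A \<union> ?B \<union> ?C"
    using assms by (auto simp: hypergraph_def)
  then have "card (edges H) \<le> card (?A \<union> ?B \<union> ?C)"
    using finite_edges[OF assms] by (intro card_mono) auto
  also have "\<dots> \<le> card ?A + card ?B + card ?C"
    using card_Un_le[of "?A \<union> ?B" ?C] card_Un_le[of ?A ?B] by linarith
  finally show ?thesis by (simp add: cut_degree_def)
qed

text \<open>With two vertices a singleton is a proper nonempty subset, so the \<open>Min\<close> in
  \<open>edge_connectivity\<close> is over a nonempty finite set and is attained.\<close>

lemma edge_connectivity_cut: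
  assumes "finite (verts H)" "card (verts H) \<ge> 2"
  obtains X where "X \<noteq> {}" "X \<subset> verts H" "cut_degree H X = edge_connectivity H"
proof -
  let ?S = "{cut_degree H X | X. X \<noteq> {} \<and> X \<subset> verts H}"
  have "?S \<subseteq> cut_degree H ` Pow (verts H)" by auto
  then have fin: "finite ?S" using assms(1) by (meson finite_Pow_iff finite_imageI finite_subset)
  obtain v where v: "v \<in> verts H" using assms(2) by fastforce
  have "{v} \<noteq> verts H" using assms(2) by (metis card.empty card_insert_disjoint
      empty_iff finite.emptyI not_less_eq_eq numeral_2_eq_2 order_refl)
  then have "{v} \<subset> verts H" using v by auto
  then have "?S \<noteq> {}" by blast
  then have "Min ?S \<in> ?S" using fin by (rule Min_in[rotated])
  then obtain X where "Min ?S = cut_degree H X" "X \<noteq> {}" "X \<subset> verts H"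
    unfolding mem_Collect_eq by (elim exE conjE)
  then show ?thesis using that[of X] by (simp add: edge_connectivity_def)
qed

text \<open>Induction on the number of vertices: from \<open>l\<close> vertices on, a minimum cut
  splits \<open>H\<close> into two induced subhypergraphs that inherit the hypotheses. Each half
  brings a surplus \<open>k\<close>; one pays for the cut, the other survives in the
  conclusion.\<close>

lemma card_edges_le_superadditive:
  fixes \<phi> :: "nat \<Rightarrow> nat"
  assumes "l \<ge> 2"
    and small: "\<And>m. 1 \<le> m \<Longrightarrow> m < l \<Longrightarrow> (m choose r) + k \<le> \<phi> m"
    and super: "\<And>a b. 1 \<le> a \<Longrightarrow> 1 \<le> b \<Longrightarrow> l \<le> a + b \<Longrightarrow> \<phi> a + \<phi> b \<le> \<phi> (a + b)"
    and "hypergraph H" "uniform r H" "card (verts H) \<ge> 1"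
    and "\<And>H'. subhypergraph H' H \<Longrightarrow> l \<le> card (verts H') \<Longrightarrow> edge_connectivity H' \<le> k"
  shows "card (edges H) + k \<le> \<phi> (card (verts H))"
  using assms(4-)
proof (induction "card (verts H)" arbitrary: H rule: less_induct)
  case less
  have fin: "finite (verts H)" using less.prems(1) by (simp add: hypergraph_def)
  show ?case
  proof (cases "card (verts H) < l")
    case True
    then show ?thesis
      using card_edges_le_choose[OF less.prems(1,2)] small[of "card (verts H)"] less.prems(3)
      by linarith
  next
    case False
    then have "2 \<le> card (verts H)" using \<open>l \<ge> 2\<close> by simp
    then obtain X where X: "X \<noteq> {}" "X \<subset> verts H" "cut_degree H X = edge_connectivity H"
      using edge_connectivity_cut fin by blast
    then have cut: "cut_degree H X \<le> k"
      using less.prems(4)[OF subhypergraph_refl[OF less.prems(1)]] False by simp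
    have part: "1 \<le> card Y \<and> card (edges (induced H Y)) + k \<le> \<phi> (card Y)"
      if Y: "Y \<noteq> {}" "Y \<subset> verts H" for Y
    proof -
      have sub: "subhypergraph (induced H Y) H"
        using Y less.prems(1) by (intro subhypergraph_induced) auto
      have pos: "1 \<le> card Y"
        using Y fin finite_subset[of Y "verts H"] by (auto simp: Suc_le_eq card_gt_0_iff)
      have "card (edges (induced H Y)) + k \<le> \<phi> (card (verts (induced H Y)))"
      proof (rule less.hyps)
        show "card (verts (induced H Y)) < card (verts H)"
          using Y fin by (simp add: psubset_card_mono)
        show "hypergraph (induced H Y)" using sub by (simp add: subhypergraph_def)
        show "uniform r (induced H Y)" using less.prems(2) by (simp add: uniform_def)
        show "1 \<le> card (verts (induced H Y))" using pos by simp
      next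
        fix H' assume "subhypergraph H' (induced H Y)" "l \<le> card (verts H')"
        then show "edge_connectivity H' \<le> k"
          using less.prems(4) subhypergraph_trans sub by blast
      qed
      then show ?thesis using pos by simp
    qed
    have sum: "card X + card (verts H - X) = card (verts H)"
      using X(2) fin card_Int_Diff[of "verts H" X] by (simp add: Int_absorb1 psubset_eq)
    have "\<phi> (card X) + \<phi> (card (verts H - X)) \<le> \<phi> (card (verts H))"
      using super[of "card X" "card (verts H - X)"] part[of X] part[of "verts H - X"] X False sum
      by (auto simp del: induced_sel)
    moreover have "card (edges (induced H X)) + k \<le> \<phi> (card X)"
      using part[of X] X by blast
    moreover have "card (edges (induced H (verts H - X))) + k \<le> \<phi> (card (verts H - X))"
      using part[of "verts H - X"] X by blast
    ultimately show ?thesis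
      using card_edges_cut[OF less.prems(1), of X] cut by linarith
  qed
qed

section \<open>Convexity and superadditivity\<close>

lemma convex_nat_increment_mono:
  fixes f :: "nat \<Rightarrow> nat"
  assumes "\<And>x. 2 * f (Suc x) \<le> f x + f (Suc (Suc x))"
  shows "f (Suc x) + f (x + d) \<le> f x + f (Suc (x + d))"
proof (induction d)
  case (Suc d)
  then show ?case using assms[of "x + d"] by simp
qed simp

text \<open>Spreading two arguments apart at a fixed sum cannot lower the total: each step of the
  induction on \<open>d\<close> compares the increment of \<open>f\<close> at \<open>u + d\<close>
  with the one at \<open>u + d + e\<close>.\<close>

lemma convex_nat_exchange:
  fixes f :: "nat \<Rightarrow> nat"
  assumes "\<And>x. 2 * f (Suc x) \<le> f x + f (Suc (Suc x))"
  shows "f (u + d) + f (u + e) \<le> f u + f (u + d + e)"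
proof (induction d)
  case (Suc d)
  then show ?case using convex_nat_increment_mono[where f = f, OF assms, of "u + d" e] by simp
qed simp

lemma convex_nat_exchange':
  fixes f :: "nat \<Rightarrow> nat"
  assumes "\<And>x. 2 * f (Suc x) \<le> f x + f (Suc (Suc x))"
    and "a \<le> L" "b \<le> L" "L \<le> a + b"
  shows "f a + f b \<le> f (a + b - L) + f L"
  using convex_nat_exchange[where f = f, OF assms(1), where u = "a + b - L" and d = "L - b" and e = "L - a"]
    assms(2-4) by simp

text \<open>By Pascal's rule the increments of \<open>x choose Suc d\<close> are
  \<open>x choose d\<close>, which never decrease in \<open>x\<close>.\<close>

lemma choose_convex: "2 * (Suc x choose r) \<le> (x choose r) + (Suc (Suc x) choose r)"
proof (cases r)
  case (Suc d)
  have "x choose d \<le> Suc x choose d" by (intro binomial_right_mono) simp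
  then show ?thesis using Suc by simp
qed simp

text \<open>Only the remainders matter. If they sum to less than \<open>L\<close>, spread them to 0
  and their sum; otherwise spread them to \<open>L\<close>, which becomes a new full block, and the
  excess over \<open>L\<close>.\<close>

lemma divmod_superadditive:
  fixes f :: "nat \<Rightarrow> nat"
  assumes convex: "\<And>x. 2 * f (Suc x) \<le> f x + f (Suc (Suc x))"
    and "f 0 = 0" "L > 0"
  shows "(a div L * f L + f (a mod L)) + (b div L * f L + f (b mod L))
    \<le> (a + b) div L * f L + f ((a + b) mod L)"
proof (cases "a mod L + b mod L < L")
  case True
  then have m: "(a + b) mod L = a mod L + b mod L"
    by (subst mod_add_eq[symmetric]) (rule mod_less[OF True])
  have d: "(a + b) div L = a div L + b div L"
    using True div_add1_eq[of a b L] by simp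
  show ?thesis
    using convex_nat_exchange[where f = f, OF convex, of 0 "a mod L" "b mod L"] \<open>f 0 = 0\<close>
    by (simp add: m d algebra_simps)
next
  case False
  have lt: "a mod L < L" "b mod L < L" using \<open>L > 0\<close> by simp_all
  define c where "c = a mod L + b mod L - L"
  have "c < L" unfolding c_def using lt by linarith
  have "a + b = (a div L * L + a mod L) + (b div L * L + b mod L)"
    by (simp only: div_mult_mod_eq)
  also have "\<dots> = c + (a div L + b div L + 1) * L"
    using False unfolding c_def add_mult_distrib by linarith
  finally have ab: "a + b = c + (a div L + b div L + 1) * L" .
  have m: "(a + b) mod L = c"
    unfolding ab mod_mult_self1 using \<open>c < L\<close> by simp
  have d: "(a + b) div L = a div L + b div L + 1"
    unfolding ab using \<open>c < L\<close> by (subst div_mult_self1) simp_all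
  show ?thesis
    using convex_nat_exchange'[where f = f, OF convex, of "a mod L" L "b mod L"] False lt
    unfolding m d add_mult_distrib c_def by linarith
qed

section \<open>The parameter \<open>s\<close>\<close>

text \<open>For \<open>r - 1 \<le> m\<close> the ratio of the two binomials is
  \<open>(m - r + 1) / r\<close>; the induction avoids the division.\<close>

lemma choose_le_mult_choose_pred:
  assumes "r \<ge> 2"
  shows "m choose r \<le> (m - 1) * (m choose (r - 1))"
proof (induction m)
  case (Suc m)
  have "Suc m choose r = (m choose (r - 1)) + (m choose r)"
    using assms by (simp add: choose_reduce_nat)
  also have "\<dots> \<le> (m choose (r - 1)) + (m - 1) * (m choose (r - 1))"
    using Suc by simp
  also have "\<dots> \<le> m * (Suc m choose (r - 1))"
  proof (cases m)
    case 0
    then show ?thesis using assms by (simp add: binomial_eq_0)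
  next
    case (Suc m')
    then have "(m choose (r - 1)) + (m - 1) * (m choose (r - 1)) = m * (m choose (r - 1))"
      by simp
    also have "\<dots> \<le> m * (Suc m choose (r - 1))"
      by (intro mult_le_mono2 binomial_right_mono) simp
    finally show ?thesis .
  qed
  finally show ?case by simp
qed (use assms in \<open>simp add: binomial_eq_0\<close>)

text \<open>Downward induction from \<open>s\<close>. If \<open>m choose (r - 1) \<ge> k\<close>,
  going from \<open>Suc m\<close> to \<open>m\<close> lowers the left side by at least the
  \<open>k\<close> lost on the right; otherwise the preceding estimate gives
  \<open>m choose r \<le> (m - 1) * k\<close> directly.\<close>

lemma choose_le_linear_antimono:
  assumes "r \<ge> 2" "1 \<le> m" "m \<le> s" "k + (s choose r) \<le> k * s"
  shows "k + (m choose r) \<le> k * m"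
  using assms(3,4,2)
proof (induction m rule: inc_induct)
  case (step m)
  have IH: "k + (Suc m choose r) \<le> k * Suc m" using step by simp
  have eq: "Suc m choose r = (m choose (r - 1)) + (m choose r)"
    using assms(1) by (simp add: choose_reduce_nat)
  show ?case
  proof (cases "m choose (r - 1) \<ge> k")
    case True
    then show ?thesis using IH eq by simp
  next
    case False
    then have "(m - 1) * (m choose (r - 1)) \<le> (m - 1) * k" by simp
    then have "m choose r \<le> (m - 1) * k"
      using choose_le_mult_choose_pred[OF assms(1), of m] by linarith
    then show ?thesis using step.prems by (cases m) (simp_all add: algebra_simps)
  qed
qed

lemma le_s_param_iff:
  assumes "r \<ge> 2" "m \<ge> 1"
  shows "m \<le> s_param k r \<longleftrightarrow> k + (m choose r) \<le> k * m"
  using choose_le_linear_antimono[OF assms(1,2) _ s_param_spec[OF assms(1)]]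
    s_param_greatest[OF assms(1)] by blast

section \<open>Superadditive bounds for large and small \<open>l\<close>\<close>

text \<open>The term \<open>k * x\<close> is the cost of splitting the part into \<open>x\<close>
  single vertices, each contributing \<open>k\<close>. The value 0 at 0 makes an empty remainder
  free.\<close>

definition part_bound :: "nat \<Rightarrow> nat \<Rightarrow> nat \<Rightarrow> nat" where
  "part_bound k r x = (if x = 0 then 0 else max ((x choose r) + k) (k * x))"

text \<open>For positive \<open>x\<close> this is a maximum of two convex functions. At 0 it holds
  because the value at 1 is \<open>k\<close> and the value at 2 is at least
  \<open>2 * k\<close>.\<close>

lemma part_bound_convex:
  assumes "r \<ge> 2"
  shows "2 * part_bound k r (Suc x) \<le> part_bound k r x + part_bound k r (Suc (Suc x))"
proof (cases "x = 0")
  case True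
  then show ?thesis using assms by (simp add: part_bound_def binomial_eq_0)
next
  case False
  then show ?thesis
    using choose_convex[of x r] by (auto simp: part_bound_def max_def algebra_simps)
qed

lemma part_bound_le_s: "r \<ge> 2 \<Longrightarrow> x \<le> s_param k r \<Longrightarrow> part_bound k r x = k * x"
  using le_s_param_iff[of r x k] by (auto simp: part_bound_def)

lemma part_bound_gt_s:
  "r \<ge> 2 \<Longrightarrow> x > s_param k r \<Longrightarrow> part_bound k r x = (x choose r) + k"
  using le_s_param_iff[of r x k] by (auto simp: part_bound_def)

text \<open>If one argument reaches \<open>L\<close>, the linear term on the right gains
  \<open>k\<close> times the other argument capped at \<open>L\<close>, which pays for its binomial
  and the second \<open>k\<close>. If neither does, convexity first moves them to \<open>L\<close>
  and \<open>a + b - L\<close>.\<close>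

lemma capped_choose_superadditive:
  assumes "r \<ge> 2" "L \<le> s_param k r" "1 \<le> a" "1 \<le> b" "L < a + b" "1 \<le> L"
  shows "((min a L choose r) + (a - L) * k + k) + ((min b L choose r) + (b - L) * k + k)
    \<le> (L choose r) + (a + b - L) * k + k"
proof -
  have linear: "k + (m choose r) \<le> k * m" if "1 \<le> m" "m \<le> L" for m
    using le_s_param_iff[OF assms(1) that(1), of k] that assms(2) by simp
  consider "L \<le> a" | "a < L" "L \<le> b" | "a < L" "b < L" by linarith
  then show ?thesis
  proof cases
    case 1
    have "a + b - L = (a - L) + (b - L) + min b L" using 1 by simp
    then have "(a + b - L) * k = (a - L) * k + (b - L) * k + k * min b L"
      by (simp add: add_mult_distrib mult.commute[of _ k] distrib_left)
    then show ?thesis using 1 linear[of "min b L"] assms by simp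
  next
    case 2
    have "a + b - L = (b - L) + a" using 2 by simp
    then have "(a + b - L) * k = (b - L) * k + k * a"
      by (simp only: add_mult_distrib mult.commute[of a])
    then show ?thesis using 2 linear[of a] assms by simp
  next
    case 3
    have "(a choose r) + (b choose r) \<le> ((a + b - L) choose r) + (L choose r)"
      using 3 assms by (intro convex_nat_exchange'[of "\<lambda>x. x choose r"] choose_convex) auto
    moreover have "k + ((a + b - L) choose r) \<le> k * (a + b - L)"
      using 3 assms by (intro linear) auto
    ultimately show ?thesis using 3 by (simp add: mult.commute)
  qed
qed

theorem theorem3p2:
  fixes H :: "'a hypergraph" and n k l r p q :: nat
  assumes "k \<ge> 2" and "r \<ge> 2"
    and "l \<ge> t_param k r + 1" and "n \<ge> l"
    and "n = p * (l - 1) + q" and "q < l - 1"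
    and "card (verts H) = n"
    and "edge_maximal r k l H"
  shows "card (edges H) \<le>
    (if l - 1 > s_param k r \<and> q > s_param k r then
       p * ((l - 1) choose r) + p * k + (q choose r)
     else if l - 1 > s_param k r \<and> q \<le> s_param k r then
       p * ((l - 1) choose r) + (p - 1 + q) * k
     else
       ((l - 1) choose r) + (n - l + 1) * k)"
proof -
  define L where "L = l - 1"
  have l: "l = L + 1" "2 \<le> L"
    using t_param_ge[of k r] assms(1-3) by (simp_all add: L_def)
  have H: "hypergraph H" "uniform r H" "1 \<le> card (verts H)"
    "\<And>H'. subhypergraph H' H \<Longrightarrow> l \<le> card (verts H') \<Longrightarrow> edge_connectivity H' \<le> k"
    using assms(4,7,8) l by (auto simp: edge_maximal_def)
  have "l \<ge> 2" using l by simp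
  note bound = card_edges_le_superadditive[OF \<open>l \<ge> 2\<close> _ _ H]
  show ?thesis
  proof (cases "L > s_param k r")
    case True
    let ?h = "part_bound k r"
    let ?\<phi> = "\<lambda>m. m div L * ?h L + ?h (m mod L)"
    have h0: "?h 0 = 0" by (simp add: part_bound_def)
    have "card (edges H) + k \<le> ?\<phi> (card (verts H))"
    proof (rule bound)
      fix m assume m: "1 \<le> m" "m < l"
      \<comment> \<open>\<open>m = L\<close> is one full block with remainder 0; smaller
        \<open>m\<close> are pure remainders.\<close>
      then have "?\<phi> m = ?h m"
        using l h0 by (cases "m = L") auto
      then show "(m choose r) + k \<le> ?\<phi> m" using m by (simp add: part_bound_def)
    next
      fix a b
      show "?\<phi> a + ?\<phi> b \<le> ?\<phi> (a + b)"
        using l h0 part_bound_convex[OF assms(2)] by (intro divmod_superadditive[where f = ?h]) auto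
    qed
    moreover have "n div L = p" "n mod L = q" using assms(5,6) l by simp_all
    moreover have "?h L = (L choose r) + k" using part_bound_gt_s assms(2) True by blast
    ultimately have main: "card (edges H) + k \<le> p * ((L choose r) + k) + ?h q"
      using assms(7) by simp
    \<comment> \<open>Needed because \<open>p - 1\<close> in the bound is truncated: the
      \<open>k\<close> on the left is cancelled against one of the \<open>p\<close> blocks.\<close>
    have "p \<noteq> 0" using assms(4-6) by (cases p) auto
    then obtain p' where p: "p = Suc p'" using not0_implies_Suc by blast
    show ?thesis
    proof (cases "q > s_param k r")
      case q: True
      then show ?thesis
        using main True part_bound_gt_s[OF assms(2) q] by (simp add: l(1) algebra_simps)
    next
      case q: False
      then show ?thesis
        using main True part_bound_le_s[OF assms(2), of q k] by (simp add: l(1) p algebra_simps)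
    qed
  next
    case False
    \<comment> \<open>Truncated subtraction makes this \<open>(m choose r) + k\<close> up to
      \<open>L\<close>; each further vertex adds \<open>k\<close>.\<close>
    let ?\<phi> = "\<lambda>m. (min m L choose r) + (m - L) * k + k"
    have "card (edges H) + k \<le> ?\<phi> (card (verts H))"
    proof (rule bound)
      fix m assume "1 \<le> m" "m < l"
      then show "(m choose r) + k \<le> ?\<phi> m" using l by (simp add: min_def)
    next
      fix a b assume "1 \<le> a" "1 \<le> b" "l \<le> a + b"
      then show "?\<phi> a + ?\<phi> b \<le> ?\<phi> (a + b)"
        using capped_choose_superadditive[of r L k a b] assms(2) False l by (simp add: min_def)
    qed
    moreover have "n - L = n - l + 1" using assms(4) l by simp
    ultimately show ?thesis using False assms(4,7) l by (simp add: min_def)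
  qed
qed

end
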